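(* There exists a set theoretic involutive non-degenerate square free solution $(X,r)$ of the Yang-Baxter equation on a finite set $X$ such that $(X,r)$ is a multipermutation solution of level $3$ and $(X,r)$ is not a generalized twisted union. Furthermore, the associated IYB group $G_r$ of this solution is abelian.
   Context: A set theoretic involutive non-degenerate solution of the Yang-Baxter equation on a finite set $X=\{x_1,\dots,x_n\}$ is a pair $(X,r)$ with $r\colon X^2\to X^2$ such that: (1) $r^2=\mathrm{id}_{X^2}$; (2) for all $i,j\in\{1,\dots,n\}$ there exist unique $k,l\in\{1,\dots,n\}$ with $r(x_i,x_k)=(x_j,x_l)$; (3) $r_{12}\circ r_{23}\circ r_{12}=r_{23}\circ r_{12}\circ r_{23}$, where $r_{ij}\colon X^3\to X^3$ acts as $r$ on the components $(i,j)$ and as the identity on the remaining component. It is square free if $r(x_i,x_i)=(x_i,x_i)$ for all $i$. The maps $\sigma_i,\gamma_i$ on $\{1,\dots,n\}$ defined by $r(x_i,x_k)=(x_{\sigma_i(k)},x_{\gamma_k(i)})$ are bijective. The group $G_r=\langle\sigma_1,\dots,\sigma_n\rangle\subseteq\operatorname{Sym}_n$ is the involutive Yang-Baxter (IYB) group of $(X,r)$; it acts on $X$ by $\sigma(x_i)=x_{\sigma(i)}$. For $x=x_i$ we also write $\sigma_x=\sigma_i$, $\gamma_x=\gamma_i$, viewed as permutations of $X$ via $x_j\mapsto x_{\sigma_i(j)}$, $x_j\mapsto x_{\gamma_i(j)}$. Retract relation: $x_i\sim x_j$ if $\sigma_i=\sigma_j$. There is a natural induced solution $Ret(X,r)=(X/\!\sim,\tilde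 r)$, given by $\tilde r([x_i],[x_j])=([x_k],[x_l])$ whenever $r(x_i,x_j)=(x_k,x_l)$. Put $Ret^0(X,r)=(X,r)$ and $Ret^{k}(X,r)=Ret(Ret^{k-1}(X,r))$. $(X,r)$ is a multipermutation solution of level $m$ if $m$ is the smallest nonnegative integer such that $Ret^m(X,r)$ has cardinality $1$. $(X,r)$ is a generalized twisted union (of solutions $(Y,r_Y)$ and $(Z,r_Z)$, the restrictions of $r$ to $Y^2$ and $Z^2$) if $X$ is a disjoint union of two non-empty $G_r$-invariant subsets $Y,Z$ such that for all $z,z'\in Z$ and $y,y'\in Y$: $$\sigma_{\gamma_{y}(z)}|_{Y}=\sigma_{\gamma_{y'}(z)}|_{Y}\quad\text{and}\quad \gamma_{\sigma_{z}(y)}|_{Z}=\gamma_{\sigma_{z'}(y)}|_{Z}.$$ "Not a generalized twisted union" means that no such decomposition $X=Y\cup Z$ exists. (For square free solutions the two conditions are equivalent to $\sigma_{\sigma_y(z)}|_Y=\sigma_z|_Y$ and $\sigma_{\sigma_z(y)}|_Z=\sigma_y|_Z$ for all $y\in Y$, $z\in Z$.) *)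

theory Defs
  imports "HOL-Algebra.Generated_Groups" "HOL-Algebra.Bij"
begin

text \<open>A pair (X, r); only the values of r on X \<times> X matter.\<close>

type_synonym 'a quadratic_set = "'a set \<times> ('a \<times> 'a \<Rightarrow> 'a \<times> 'a)"

definition r12 :: "('a \<times> 'a \<Rightarrow> 'a \<times> 'a) \<Rightarrow> 'a \<times> 'a \<times> 'a \<Rightarrow> 'a \<times> 'a \<times> 'a" where
  "r12 r = (\<lambda>(x, y, z). let (u, v) = r (x, y) in (u, v, z))"

definition r23 :: "('a \<times> 'a \<Rightarrow> 'a \<times> 'a) \<Rightarrow> 'a \<times> 'a \<times> 'a \<Rightarrow> 'a \<times> 'a \<times> 'a" where
  "r23 r = (\<lambda>(x, y, z). let (u, v) = r (y, z) in (x, u, v))"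

definition inv_nondeg_solution :: "'a quadratic_set \<Rightarrow> bool" where
  "inv_nondeg_solution S \<longleftrightarrow> (case S of (X, r) \<Rightarrow>
     finite X \<and>
     r \<in> X \<times> X \<rightarrow> X \<times> X \<and>
     (\<forall>p \<in> X \<times> X. r (r p) = p) \<and>
     (\<forall>x \<in> X. \<forall>y \<in> X. \<exists>!p. p \<in> X \<times> X \<and> r (x, fst p) = (y, snd p)) \<and>
     (\<forall>t \<in> X \<times> X \<times> X.
        (r12 r \<circ> r23 r \<circ> r12 r) t = (r23 r \<circ> r12 r \<circ> r23 r) t))"

definition square_free_solution :: "'a quadratic_set \<Rightarrow> bool" where
  "square_free_solution S \<longleftrightarrow> (\<forall>x \<in> fst S. snd S (x, x) = (x, x))"

text \<open>On X, r (x, y) = (\<sigma> x y, \<gamma> y x). Both maps are made undefined outside X, so that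
  equality of maps is equality on X.\<close>

definition sigma :: "'a quadratic_set \<Rightarrow> 'a \<Rightarrow> 'a \<Rightarrow> 'a" where
  "sigma S x = (\<lambda>y \<in> fst S. fst (snd S (x, y)))"

definition gamma :: "'a quadratic_set \<Rightarrow> 'a \<Rightarrow> 'a \<Rightarrow> 'a" where
  "gamma S y = (\<lambda>x \<in> fst S. snd (snd S (x, y)))"

definition IYB_carrier :: "'a quadratic_set \<Rightarrow> ('a \<Rightarrow> 'a) set" where
  "IYB_carrier S = generate (BijGroup (fst S)) (sigma S ` fst S)"

definition IYB_group :: "'a quadratic_set \<Rightarrow> ('a \<Rightarrow> 'a) monoid" where
  "IYB_group S = (BijGroup (fst S))\<lparr>carrier := IYB_carrier S\<rparr>"

definition retract_rel :: "'a quadratic_set \<Rightarrow> ('a \<times> 'a) set" where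
  "retract_rel S = {(x, y). x \<in> fst S \<and> y \<in> fst S \<and> sigma S x = sigma S y}"

text \<open>The induced map is determined by its values on representatives; for an involutive
  non-degenerate solution these do not depend on the representatives, so the description
  is definite on pairs of classes.\<close>

definition Ret :: "'a quadratic_set \<Rightarrow> 'a set quadratic_set" where
  "Ret S = (fst S // retract_rel S,
     \<lambda>(A, B). THE p. \<forall>x \<in> A. \<forall>y \<in> B. \<forall>k l. snd S (x, y) = (k, l) \<longrightarrow>
        p = (retract_rel S `` {k}, retract_rel S `` {l}))"

text \<open>Each application of \<^const>\<open>Ret\<close> changes the type of the points, so it cannot be iterated
  by a number variable; minimality of the level 3 is therefore written out.\<close>

definition multipermutation_level_3 :: "'a quadratic_set \<Rightarrow> bool" where
  "multipermutation_level_3 S \<longleftrightarrow>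
     card (fst S) \<noteq> 1 \<and>
     card (fst (Ret S)) \<noteq> 1 \<and>
     card (fst (Ret (Ret S))) \<noteq> 1 \<and>
     card (fst (Ret (Ret (Ret S)))) = 1"

text \<open>For an involutive non-degenerate solution, invariance of Y and Z already implies that r
  restricts to solutions on them, since \<gamma> y x is the preimage of x under the permutation
  belonging to \<sigma> x y.\<close>

definition generalized_twisted_union :: "'a quadratic_set \<Rightarrow> bool" where
  "generalized_twisted_union S \<longleftrightarrow> (\<exists>Y Z.
     Y \<noteq> {} \<and> Z \<noteq> {} \<and> Y \<inter> Z = {} \<and> Y \<union> Z = fst S \<and>
     (\<forall>g \<in> IYB_carrier S. g ` Y \<subseteq> Y \<and> g ` Z \<subseteq> Z) \<and>
     (\<forall>z \<in> Z. \<forall>z' \<in> Z. \<forall>y \<in> Y. \<forall>y' \<in> Y.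
        restrict (sigma S (gamma S y z)) Y = restrict (sigma S (gamma S y' z)) Y \<and>
        restrict (gamma S (sigma S z y)) Z = restrict (gamma S (sigma S z' y)) Z))"

end

theory Submission
  imports Defs
begin

text \<open>
  The example has three \<open>G\<^sub>r\<close>-orbits \<open>A = {0,1,2,3}\<close>, \<open>B = {4,5,6,7}\<close>, \<open>C = {8,9,10,11}\<close>, each
  regarded as a copy of \<open>\<bbbF>\<^sub>2\<^sup>2\<close> through the two lowest binary digits (high digit first), and every
  \<open>\<sigma>\<^sub>x\<close> translates each orbit. Hence the maps \<open>\<sigma>\<^sub>x\<close> are commuting involutions and \<open>G\<^sub>r\<close> is abelian.
  This form is forced up to the choice of groups: an abelian group acts regularly, modulo
  stabilizers, on each of its orbits, so the condition \<open>\<sigma>\<^sub>x(x) = x\<close> makes \<open>\<sigma>\<^sub>x\<close> trivial on the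
  orbit of \<open>x\<close>.
  Write \<open>f\<^sub>i\<^sub>j(x)\<close> for the vector by which \<open>x\<close> in the orbit \<open>i\<close> translates the orbit \<open>j\<close>. The
  Yang-Baxter equation becomes the cocycle condition
  \<open>f\<^sub>j\<^sub>k(y + f\<^sub>i\<^sub>j(x)) - f\<^sub>j\<^sub>k(y) = f\<^sub>i\<^sub>k(x + f\<^sub>j\<^sub>i(y)) - f\<^sub>i\<^sub>k(x)\<close>
  (signs do not matter here), and a decomposition that puts the orbits \<open>i\<close> and \<open>j\<close> on different
  sides is not a generalized twisted union as soon as this common value is nonzero for some \<open>k\<close>, \<open>x\<close> and \<open>y\<close>.
  It therefore suffices to make it nonzero for the pairs \<open>A, B\<close> (acting on \<open>C\<close>) and \<open>B, C\<close> (acting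
  on \<open>A\<close>), because every decomposition into unions of orbits separates one of these pairs.

  A point of \<open>A\<close> with digits \<open>(p, q)\<close> translates \<open>B\<close> by \<open>(1, 0)\<close> and \<open>C\<close> by \<open>(0, p)\<close>; a point
  \<open>(a, b)\<close> of \<open>B\<close> translates \<open>A\<close> by \<open>(1, b)\<close> and \<open>C\<close> by \<open>(1, a)\<close>; a point \<open>(c, d)\<close> of \<open>C\<close> translates
  \<open>A\<close> by \<open>(0, c)\<close> and \<open>B\<close> by \<open>(0, 1)\<close>. So \<open>A\<close> flips the digit \<open>a\<close> and \<open>B\<close> flips the digit \<open>p\<close>, and both
  flips change the translation of \<open>C\<close> by the same vector \<open>(0, 1)\<close>; the pair \<open>B, C\<close> behaves in the
  same way over \<open>A\<close>.

  For the multipermutation level, the low digits of \<open>A\<close> and \<open>C\<close> do not influence any translation,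
  and the retract forgets exactly these two digits. In the retract, which has \<open>2 + 4 + 2\<close> points,
  translations depend only on the orbit of the acting point, so the second retract has three
  points; on it every \<open>\<sigma>\<^sub>x\<close> is the identity, so the third one is a single point. The passage from
  these explicit maps to \<^const>\<open>Ret\<close> is made by \<open>quadratic_iso_Ret\<close>: a surjective homomorphism
  whose fibres are the classes of the retract relation has a target isomorphic to the retract.
\<close>
section \<open>Solutions from commuting involutions\<close>

text \<open>When every \<open>s x = \<sigma>\<^sub>x\<close> is an involution, \<open>r\<^sup>2 = id\<close> forces the second component
  \<open>\<sigma>\<^sup>-\<^sup>1\<^bsub>\<sigma>\<^sub>x(y)\<^esub>(x)\<close>, in which the inverse can then be omitted.\<close>
definition sol_of :: "'a set \<Rightarrow> ('a \<Rightarrow> 'a \<Rightarrow> 'a) \<Rightarrow> 'a quadratic_set" where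
  "sol_of X s = (X, \<lambda>(x, y). (s x y, s (s x y) x))"

lemma fst_sol_of [simp]: "fst (sol_of X s) = X"
  by (simp add: sol_of_def)

lemma snd_sol_of [simp]: "snd (sol_of X s) (x, y) = (s x y, s (s x y) x)"
  by (simp add: sol_of_def)

lemma sigma_sol_of: "sigma (sol_of X s) x = restrict (s x) X"
  by (simp add: sigma_def sol_of_def)

text \<open>With \<open>x \<cdot> y = s x y\<close>, the last axiom is Rump's identity
  \<open>(x \<cdot> y) \<cdot> (x \<cdot> z) = (y \<cdot> x) \<cdot> (y \<cdot> z)\<close> for cycle sets; the operation of the cycle set of a solution
  is in general \<open>\<sigma>\<^sub>x\<^sup>-\<^sup>1(y)\<close>.\<close>
locale involutive_cycle_set =
  fixes X :: "'a set" and s :: "'a \<Rightarrow> 'a \<Rightarrow> 'a"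
  assumes finite: "finite X"
    and closed: "\<lbrakk>x \<in> X; y \<in> X\<rbrakk> \<Longrightarrow> s x y \<in> X"
    and invol: "\<lbrakk>x \<in> X; y \<in> X\<rbrakk> \<Longrightarrow> s x (s x y) = y"
    and commute: "\<lbrakk>x \<in> X; y \<in> X; z \<in> X\<rbrakk> \<Longrightarrow> s x (s y z) = s y (s x z)"
    and cycle: "\<lbrakk>x \<in> X; y \<in> X; z \<in> X\<rbrakk> \<Longrightarrow> s (s x y) (s x z) = s (s y x) (s y z)"
begin

text \<open>Each of the three components of the braid relation is one instance of the cycle identity (for the first
  one, combined with commutativity).
  The instances are found by naming the intermediate results \<open>u, v\<close> of \<open>r(x, y)\<close> and \<open>p\<close> of
  \<open>r(y, z)\<close>, and inverting, as in \<open>s x u = y\<close>, \<open>s u v = x\<close>.\<close>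
lemma braid:
  assumes X: "x \<in> X" "y \<in> X" "z \<in> X"
  defines "r \<equiv> snd (sol_of X s)"
  shows "(r12 r \<circ> r23 r \<circ> r12 r) (x, y, z) = (r23 r \<circ> r12 r \<circ> r23 r) (x, y, z)"
proof -
  define u where "u = s x y"
  define v where "v = s u x"
  define p where "p = s y z"
  define q where "q = s p y"
  define A where "A = s x p"
  have inX: "u \<in> X" "v \<in> X" "p \<in> X" "q \<in> X" "A \<in> X"
    using X by (auto simp: u_def v_def p_def q_def A_def closed)
  have xu: "s x u = y" and uv: "s u v = x" and xA: "s x A = p" and yp: "s y p = z" and pq: "s p q = y"
    using X inX by (simp_all add: u_def v_def A_def p_def q_def invol)
  have first: "s u (s v z) = A"
  proof -
    \<comment> \<open>The two sides are \<open>\<sigma>\<^sub>u \<sigma>\<^sub>v\<close> and \<open>\<sigma>\<^sub>x \<sigma>\<^sub>y\<close> at \<open>z\<close>; the cycle identity for \<open>x, u\<close> compares them.\<close>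
    have "s y (s x z) = s v (s u z)"
      using cycle[of x u z] X inX by (simp add: xu v_def)
    then show ?thesis
      using X inX by (simp add: A_def p_def commute[of x y] commute[of u v])
  qed
  have second: "s A u = s (s A x) q"
  proof -
    have "s (s A x) (s A u) = s (s x A) (s x u)"
      using cycle[of A x u] X inX by simp
    also have "\<dots> = q" by (simp add: xA xu q_def)
    finally have "s (s A x) (s A u) = q" .
    then show ?thesis
      using X inX invol[of "s A x" "s A u"] by (simp add: closed)
  qed
  have third: "s (s v z) v = s (s A u) (s A x)"
  proof -
    have "s u A = s v z"
      using first invol[of u "s v z"] X inX by (simp add: closed)
    then show ?thesis
      using cycle[of A u x] X inX by (simp add: v_def)
  qed
  show ?thesis
    using first second third
    by (simp add: r_def r12_def r23_def u_def[symmetric] v_def[symmetric] p_def[symmetric]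
        q_def[symmetric] A_def[symmetric])
qed

lemma inv_nondeg_solution: "inv_nondeg_solution (sol_of X s)"
proof -
  let ?r = "snd (sol_of X s)"
  have "?r \<in> X \<times> X \<rightarrow> X \<times> X"
    by (auto simp: closed)
  moreover have "?r (?r w) = w" if "w \<in> X \<times> X" for w
    using that by (auto simp: closed invol)
  moreover have "\<exists>!w. w \<in> X \<times> X \<and> ?r (x, fst w) = (y, snd w)" if "x \<in> X" "y \<in> X" for x y
  proof (rule ex1I[of _ "(s x y, s y x)"])
    show "(s x y, s y x) \<in> X \<times> X \<and> ?r (x, fst (s x y, s y x)) = (y, snd (s x y, s y x))"
      using that by (simp add: closed invol)
  next
    fix w assume "w \<in> X \<times> X \<and> ?r (x, fst w) = (y, snd w)"
    then show "w = (s x y, s y x)"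
      using that invol[of x "fst w"] by (auto simp: prod_eq_iff)
  qed
  ultimately show ?thesis
    using finite braid by (auto simp: inv_nondeg_solution_def sol_of_def)
qed

lemma sigma_in_Bij:
  assumes "x \<in> X"
  shows "sigma (sol_of X s) x \<in> Bij X"
proof -
  have "bij_betw (s x) X X"
    by (rule bij_betwI[of _ _ _ "s x"]) (use assms in \<open>auto simp: closed invol\<close>)
  then show ?thesis
    by (simp add: sigma_sol_of Bij_def)
qed

end

text \<open>An element that commutes with all generators commutes with everything that they generate.
  This is used twice: for a generator, and then for an arbitrary generated element.\<close>
lemma (in group) comm_group_generate:
  assumes S: "S \<subseteq> carrier G"
    and comm: "\<And>a b. \<lbrakk>a \<in> S; b \<in> S\<rbrakk> \<Longrightarrow> a \<otimes> b = b \<otimes> a"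
  shows "comm_group (G\<lparr>carrier := generate G S\<rparr>)"
proof -
  have central: "g \<otimes> a = a \<otimes> g"
    if a: "a \<in> carrier G" and aS: "\<And>b. b \<in> S \<Longrightarrow> b \<otimes> a = a \<otimes> b" and g: "g \<in> generate G S" for a g
    using g
  proof induction
    case one
    then show ?case using a by simp
  next
    case (incl h)
    then show ?case by (rule aS)
  next
    case (inv h)
    then have "h \<in> carrier G" using S by blast
    then have "inv h \<otimes> a = inv h \<otimes> (a \<otimes> h) \<otimes> inv h"
      using a by (simp add: m_assoc)
    also have "\<dots> = inv h \<otimes> (h \<otimes> a) \<otimes> inv h"
      by (simp add: aS[OF inv])
    also have "\<dots> = a \<otimes> inv h"
      using a \<open>h \<in> carrier G\<close> by (simp flip: m_assoc)
    finally show ?case .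
  next
    case (eng g h)
    then have "g \<in> carrier G" "h \<in> carrier G"
      using generate_in_carrier[OF S] by auto
    then show ?case using a eng by (metis m_assoc)
  qed
  have comm_S: "g \<otimes> a = a \<otimes> g" if "a \<in> S" "g \<in> generate G S" for g a
    using that S comm by (intro central[of a g]) auto
  have "g \<otimes> h = h \<otimes> g" if "g \<in> generate G S" "h \<in> generate G S" for g h
    using that comm_S generate_in_carrier[OF S] by (intro central[of h g]) auto
  then show ?thesis
    using subgroup_imp_group[OF generate_is_subgroup[OF S]]
    by (intro group.group_comm_groupI) auto
qed

lemma (in involutive_cycle_set) comm_group_IYB: "comm_group (IYB_group (sol_of X s))"
proof -
  interpret group "BijGroup X" by (rule group_BijGroup)
  show ?thesis
    unfolding IYB_group_def IYB_carrier_def fst_sol_of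
  proof (rule comm_group_generate)
    show "sigma (sol_of X s) ` X \<subseteq> carrier (BijGroup X)"
      using sigma_in_Bij by (auto simp: BijGroup_def)
  next
    fix a b assume "a \<in> sigma (sol_of X s) ` X" "b \<in> sigma (sol_of X s) ` X"
    then show "a \<otimes>\<^bsub>BijGroup X\<^esub> b = b \<otimes>\<^bsub>BijGroup X\<^esub> a"
      using sigma_in_Bij
      by (auto simp: BijGroup_def compose_def sigma_sol_of fun_eq_iff closed commute)
  qed
qed

section \<open>Computing retracts\<close>

text \<open>Every application of \<^const>\<open>Ret\<close> produces classes of classes. The notions below make it possible
  to replace each retract by an explicit isomorphic copy before the next retract is taken.\<close>
definition quadratic_closed :: "'a quadratic_set \<Rightarrow> bool" where
  "quadratic_closed S \<longleftrightarrow> snd S \<in> fst S \<times> fst S \<rightarrow> fst S \<times> fst S"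

definition quadratic_epi :: "('a \<Rightarrow> 'b) \<Rightarrow> 'a quadratic_set \<Rightarrow> 'b quadratic_set \<Rightarrow> bool" where
  "quadratic_epi h S T \<longleftrightarrow> h ` fst S = fst T \<and>
     (\<forall>x \<in> fst S. \<forall>y \<in> fst S. snd T (h x, h y) = map_prod h h (snd S (x, y)))"

definition quadratic_iso :: "('a \<Rightarrow> 'b) \<Rightarrow> 'a quadratic_set \<Rightarrow> 'b quadratic_set \<Rightarrow> bool" where
  "quadratic_iso h S T \<longleftrightarrow> quadratic_epi h S T \<and> inj_on h (fst S)"

text \<open>A retraction map identifies exactly the points that the retract relation identifies, so it
  plays the part of the canonical projection \<open>X \<rightarrow> X/\<sim>\<close>.\<close>
definition retraction_map :: "('a \<Rightarrow> 'b) \<Rightarrow> 'a quadratic_set \<Rightarrow> 'b quadratic_set \<Rightarrow> bool" where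
  "retraction_map h S T \<longleftrightarrow> quadratic_epi h S T \<and>
     (\<forall>x \<in> fst S. \<forall>y \<in> fst S. h x = h y \<longleftrightarrow> sigma S x = sigma S y)"

lemma quadratic_closed_hom:
  assumes "quadratic_closed S" "quadratic_epi h S T"
  shows "quadratic_closed T"
  unfolding quadratic_closed_def
proof (rule funcsetI)
  fix w assume "w \<in> fst T \<times> fst T"
  then have "fst w \<in> h ` fst S" "snd w \<in> h ` fst S"
    using assms(2) by (auto simp: quadratic_epi_def)
  then obtain x y where xy: "x \<in> fst S" "y \<in> fst S" and w: "w = (h x, h y)"
    by (metis imageE prod.collapse)
  have "snd S (x, y) \<in> fst S \<times> fst S"
    using assms(1) xy by (auto simp: quadratic_closed_def)
  moreover have "snd T w = map_prod h h (snd S (x, y))" "h ` fst S = fst T"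
    using assms(2) xy w by (auto simp: quadratic_epi_def)
  ultimately show "snd T w \<in> fst T \<times> fst T"
    by (cases "snd S (x, y)") auto
qed

text \<open>A class of the retract relation is a fibre of \<open>h\<close>. Since \<open>h\<close> is a homomorphism, the classes of
  the components of \<open>r(x, y)\<close> depend only on \<open>h x\<close> and \<open>h y\<close>. This is the well-definedness that the
  definite description in \<^const>\<open>Ret\<close> requires, and it identifies its value.\<close>
lemma quadratic_iso_Ret:
  assumes closed: "quadratic_closed S" and h: "retraction_map h S T"
  shows "quadratic_iso (\<lambda>t. {x \<in> fst S. h x = t}) T (Ret S)"
proof -
  define fib where "fib t = {x \<in> fst S. h x = t}" for t
  have im: "h ` fst S = fst T"
    and hom: "\<And>x y. \<lbrakk>x \<in> fst S; y \<in> fst S\<rbrakk> \<Longrightarrow> snd T (h x, h y) = map_prod h h (snd S (x, y))"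
    and ker: "\<And>x y. \<lbrakk>x \<in> fst S; y \<in> fst S\<rbrakk> \<Longrightarrow> h x = h y \<longleftrightarrow> sigma S x = sigma S y"
    using h by (auto simp: retraction_map_def quadratic_epi_def)
  have cls: "retract_rel S `` {x} = fib (h x)" if "x \<in> fst S" for x
    using that ker by (auto simp: retract_rel_def fib_def)
  have carrier: "fst (Ret S) = fib ` fst T"
    using cls by (auto simp: Ret_def quotient_def im[symmetric])
  have ret: "snd (Ret S) (fib t, fib t') = map_prod fib fib (snd T (t, t'))"
    if "t \<in> fst T" "t' \<in> fst T" for t t'
  proof -
    have all: "(retract_rel S `` {k}, retract_rel S `` {l}) = map_prod fib fib (snd T (t, t'))"
      if "x \<in> fib t" "y \<in> fib t'" "snd S (x, y) = (k, l)" for x y k l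
    proof -
      have xy: "x \<in> fst S" "y \<in> fst S" "h x = t" "h y = t'"
        using that by (auto simp: fib_def)
      have "(k, l) \<in> fst S \<times> fst S"
        using closed xy that(3) by (force simp: quadratic_closed_def)
      then show ?thesis
        using hom[OF xy(1,2)] that(3) xy cls by simp
    qed
    have "\<exists>x. x \<in> fib u" if "u \<in> fst T" for u
      using that by (auto simp: fib_def im[symmetric])
    then obtain x y where xy: "x \<in> fib t" "y \<in> fib t'"
      using \<open>t \<in> fst T\<close> \<open>t' \<in> fst T\<close> by meson
    obtain k l where kl: "snd S (x, y) = (k, l)" by fastforce
    show ?thesis
      unfolding Ret_def snd_conv prod.case
    proof (rule the_equality)
      show "\<forall>x\<in>fib t. \<forall>y\<in>fib t'. \<forall>k l. snd S (x, y) = (k, l) \<longrightarrow>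
          map_prod fib fib (snd T (t, t')) = (retract_rel S `` {k}, retract_rel S `` {l})"
        using all by metis
    next
      fix w
      assume "\<forall>x\<in>fib t. \<forall>y\<in>fib t'. \<forall>k l. snd S (x, y) = (k, l) \<longrightarrow>
          w = (retract_rel S `` {k}, retract_rel S `` {l})"
      then show "w = map_prod fib fib (snd T (t, t'))"
        using all[OF xy kl] xy kl by metis
    qed
  qed
  have "inj_on fib (fst T)"
    unfolding im[symmetric] inj_on_def fib_def by blast
  then have "quadratic_iso fib T (Ret S)"
    using carrier ret by (auto simp: quadratic_iso_def quadratic_epi_def)
  then show ?thesis by (simp add: fib_def[abs_def])
qed

text \<open>Together with \<open>quadratic_iso_Ret\<close> this iterates: a retraction map of a copy of the retract gives
  a copy of the second retract.\<close>
lemma retraction_map_iso: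
  assumes closed: "quadratic_closed S" and g: "quadratic_iso g S S'" and h: "retraction_map h S T"
  shows "retraction_map (h \<circ> inv_into (fst S) g) S' T"
proof -
  let ?f = "inv_into (fst S) g"
  have inj: "inj_on g (fst S)" and im: "fst S' = g ` fst S"
    and hom: "\<And>x y. \<lbrakk>x \<in> fst S; y \<in> fst S\<rbrakk> \<Longrightarrow> snd S' (g x, g y) = map_prod g g (snd S (x, y))"
    using g by (auto simp: quadratic_iso_def quadratic_epi_def)
  have f: "?f (g x) = x" if "x \<in> fst S" for x
    using that inj by simp
  have r_in: "snd S (x, y) \<in> fst S \<times> fst S" if "x \<in> fst S" "y \<in> fst S" for x y
    using closed that by (auto simp: quadratic_closed_def)
  have sig: "sigma S' (g x) (g y) = g (sigma S x y)" if "x \<in> fst S" "y \<in> fst S" for x y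
    using that hom by (simp add: sigma_def im)
  have sig_in: "sigma S x y \<in> fst S" if "x \<in> fst S" "y \<in> fst S" for x y
    using r_in[OF that] that by (auto simp: sigma_def mem_Times_iff)
  have sig_eq: "sigma S' (g x) = sigma S' (g y) \<longleftrightarrow> sigma S x = sigma S y"
    if xy: "x \<in> fst S" "y \<in> fst S" for x y
  proof
    assume eq: "sigma S' (g x) = sigma S' (g y)"
    show "sigma S x = sigma S y"
    proof
      fix z show "sigma S x z = sigma S y z"
      proof (cases "z \<in> fst S")
        case True
        then have "g (sigma S x z) = g (sigma S y z)"
          using eq sig xy by metis
        then show ?thesis
          using inj sig_in xy True by (meson inj_onD)
      qed (simp add: sigma_def)
    qed
  next
    assume eq: "sigma S x = sigma S y"
    show "sigma S' (g x) = sigma S' (g y)"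
    proof
      fix z show "sigma S' (g x) z = sigma S' (g y) z"
      proof (cases "z \<in> fst S'")
        case True
        then show ?thesis using sig xy eq by (auto simp: im)
      qed (simp add: sigma_def)
    qed
  qed
  have "map_prod (h \<circ> ?f) (h \<circ> ?f) (snd S' (g x, g y)) = map_prod h h (snd S (x, y))"
    if "x \<in> fst S" "y \<in> fst S" for x y
    using hom[OF that] r_in[OF that] f by (cases "snd S (x, y)") auto
  then show ?thesis
    using h sig_eq f by (auto simp: retraction_map_def quadratic_epi_def im image_image)
qed

lemma quadratic_iso_card:
  assumes "quadratic_iso g S T"
  shows "card (fst T) = card (fst S)"
  using assms card_image unfolding quadratic_iso_def quadratic_epi_def by metis

lemma multipermutation_level_3I:
  assumes closed: "quadratic_closed S"
    and h1: "retraction_map h1 S T1" and h2: "retraction_map h2 T1 T2" and h3: "retraction_map h3 T2 T3"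
    and card: "card (fst S) \<noteq> 1" "card (fst T1) \<noteq> 1" "card (fst T2) \<noteq> 1" "card (fst T3) = 1"
  shows "multipermutation_level_3 S"
proof -
  note hom = retraction_map_def[THEN iffD1, THEN conjunct1]
  have closed1: "quadratic_closed T1" using quadratic_closed_hom closed hom[OF h1] .
  have closed2: "quadratic_closed T2" using quadratic_closed_hom closed1 hom[OF h2] .
  note iso_hom = quadratic_iso_def[THEN iffD1, THEN conjunct1]
  obtain g1 where g1: "quadratic_iso g1 T1 (Ret S)"
    using quadratic_iso_Ret[OF closed h1] by blast
  note closed_R1 = quadratic_closed_hom[OF closed1 iso_hom[OF g1]]
  obtain g2 where g2: "quadratic_iso g2 T2 (Ret (Ret S))"
    using quadratic_iso_Ret[OF closed_R1 retraction_map_iso[OF closed1 g1 h2]] by blast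
  note closed_R2 = quadratic_closed_hom[OF closed2 iso_hom[OF g2]]
  obtain g3 where g3: "quadratic_iso g3 T3 (Ret (Ret (Ret S)))"
    using quadratic_iso_Ret[OF closed_R2 retraction_map_iso[OF closed2 g2 h3]] by blast
  show ?thesis
    using card quadratic_iso_card[OF g1] quadratic_iso_card[OF g2] quadratic_iso_card[OF g3]
    by (simp add: multipermutation_level_3_def)
qed

section \<open>Generalized twisted unions\<close>

text \<open>A pointwise form of the conditions, in which the generated group and the restricted
  functions no longer occur.\<close>
lemma twisted_union_condition:
  assumes "generalized_twisted_union (sol_of X s)"
    and X: "\<And>x y. \<lbrakk>x \<in> X; y \<in> X\<rbrakk> \<Longrightarrow> s x y \<in> X"
  obtains Y Z where "Y \<noteq> {}" "Z \<noteq> {}" "Y \<inter> Z = {}" "Y \<union> Z = X"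
    and "\<forall>x\<in>X. \<forall>y\<in>Y. s x y \<in> Y"
    and "\<forall>x\<in>X. \<forall>z\<in>Z. s x z \<in> Z"
    and "\<forall>z\<in>Z. \<forall>y\<in>Y. \<forall>y'\<in>Y. \<forall>w\<in>Y. s (s (s z y) z) w = s (s (s z y') z) w"
    and "\<forall>z\<in>Z. \<forall>z'\<in>Z. \<forall>y\<in>Y. \<forall>w\<in>Z. s (s w (s z y)) w = s (s w (s z' y)) w"
proof -
  obtain Y Z where YZ: "Y \<noteq> {}" "Z \<noteq> {}" "Y \<inter> Z = {}" "Y \<union> Z = X"
    and inv: "\<forall>g \<in> IYB_carrier (sol_of X s). g ` Y \<subseteq> Y \<and> g ` Z \<subseteq> Z"
    and tw: "\<forall>z \<in> Z. \<forall>z' \<in> Z. \<forall>y \<in> Y. \<forall>y' \<in> Y.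
        restrict (sigma (sol_of X s) (gamma (sol_of X s) y z)) Y =
          restrict (sigma (sol_of X s) (gamma (sol_of X s) y' z)) Y \<and>
        restrict (gamma (sol_of X s) (sigma (sol_of X s) z y)) Z =
          restrict (gamma (sol_of X s) (sigma (sol_of X s) z' y)) Z"
    using assms(1) unfolding generalized_twisted_union_def fst_sol_of by (elim exE conjE) (rule that)
  have gen: "restrict (s x) X ` Y \<subseteq> Y \<and> restrict (s x) X ` Z \<subseteq> Z" if "x \<in> X" for x
  proof -
    have "sigma (sol_of X s) x \<in> IYB_carrier (sol_of X s)"
      unfolding IYB_carrier_def using that by (auto intro: generate.incl)
    then show ?thesis using bspec[OF inv] by (simp only: sigma_sol_of)
  qed
  have sub: "y \<in> X" if "y \<in> Y \<or> y \<in> Z" for y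
    using that YZ by blast
  show ?thesis
  proof (rule that[OF YZ])
    show "\<forall>x\<in>X. \<forall>y\<in>Y. s x y \<in> Y" "\<forall>x\<in>X. \<forall>z\<in>Z. s x z \<in> Z"
      using gen sub by (auto simp: image_subset_iff)
    show "\<forall>z\<in>Z. \<forall>y\<in>Y. \<forall>y'\<in>Y. \<forall>w\<in>Y. s (s (s z y) z) w = s (s (s z y') z) w"
    proof (intro ballI)
      fix z y y' w assume "z \<in> Z" "y \<in> Y" "y' \<in> Y" "w \<in> Y"
      then show "s (s (s z y) z) w = s (s (s z y') z) w"
        using fun_cong[OF conjunct1[OF tw[rule_format, of z z y y']], of w] sub
        by (simp add: sigma_sol_of gamma_def X)
    qed
    show "\<forall>z\<in>Z. \<forall>z'\<in>Z. \<forall>y\<in>Y. \<forall>w\<in>Z. s (s w (s z y)) w = s (s w (s z' y)) w"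
    proof (intro ballI)
      fix z z' y w assume "z \<in> Z" "z' \<in> Z" "y \<in> Y" "w \<in> Z"
      then show "s (s w (s z y)) w = s (s w (s z' y)) w"
        using fun_cong[OF conjunct2[OF tw[rule_format, of z z' y y]], of w] sub
        by (simp add: sigma_sol_of gamma_def X)
    qed
  qed
qed

section \<open>A solution with twelve points\<close>

text \<open>The vector by which \<open>x\<close> translates the orbit \<open>{4 * k..<4 * k + 4}\<close>, coded as a number below 4.
  The orbits \<open>A\<close>, \<open>B\<close>, \<open>C\<close> have the indices 0, 1, 2. Membership in \<open>{2, 3}\<close>, \<open>{6, 7}\<close> or \<open>{10, 11}\<close>
  says that the high digit of \<open>x\<close> is 1, membership in \<open>{5, 7}\<close> that the low digit is.\<close>
definition shift :: "nat \<Rightarrow> nat \<Rightarrow> nat" where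
  "shift x k =
     (if x < 4 then (if k = 1 then 2 else if k = 2 \<and> x \<in> {2, 3} then 1 else 0)
      else if x < 8 then
        (if k = 0 then (if x \<in> {5, 7} then 3 else 2)
         else if k = 2 then (if x \<in> {6, 7} then 3 else 2) else 0)
      else (if k = 1 then 1 else if k = 0 \<and> x \<in> {10, 11} then 1 else 0))"

definition act :: "nat \<Rightarrow> nat \<Rightarrow> nat" where
  "act x y = xor y (shift x (y div 4))"

text \<open>Clears the low digit in the orbits \<open>A\<close> and \<open>C\<close>, so that the first retract is represented by
  the even points of \<open>A\<close> and \<open>C\<close> and all points of \<open>B\<close>.\<close>
definition half_collapse :: "nat \<Rightarrow> nat" where
  "half_collapse x = (if x div 4 = 1 then x else x div 2 * 2)"

lemma xor_small_div_4:
  fixes y a :: nat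
  assumes "a < 4"
  shows "xor y a div 4 = y div 4"
proof -
  have "drop_bit 2 (xor y a) = drop_bit 2 y"
    using assms by (simp add: drop_bit_eq_div[of _ a])
  then show ?thesis by (simp add: drop_bit_eq_div)
qed

lemma shift_less: "shift x k < 4"
  by (simp add: shift_def)

lemma act_div_4: "act x y div 4 = y div 4"
  by (simp add: act_def xor_small_div_4 shift_less)

lemma act_less_12:
  assumes "y < 12"
  shows "act x y < 12"
proof -
  have "y div 4 < 3" using assms by linarith
  then have "act x y div 4 < 3" by (simp only: act_div_4)
  then show ?thesis by linarith
qed

lemma act_commute: "act x (act y z) = act y (act x z)"
  by (simp add: act_def xor_small_div_4 shift_less xor.assoc xor.commute xor.left_commute)

lemma act_act: "act x (act x y) = y"
  by (simp add: act_def xor_small_div_4 shift_less xor.assoc)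

lemma all_less_3: "(\<forall>x<3. P x) \<longleftrightarrow> P 0 \<and> P 1 \<and> P (2 :: nat)"
  by (simp add: numeral_eq_Suc All_less_Suc) blast

lemma all_less_12:
  "(\<forall>x<12. P x) \<longleftrightarrow>
     P 0 \<and> P 1 \<and> P 2 \<and> P 3 \<and> P 4 \<and> P 5 \<and> P 6 \<and> P 7 \<and> P 8 \<and> P 9 \<and> P 10 \<and> P (11 :: nat)"
  by (simp add: numeral_eq_Suc All_less_Suc) blast

text \<open>The cocycle condition in characteristic 2. It is nontrivial only if \<open>x\<close> and \<open>y\<close> come from \<open>A\<close> and
  \<open>B\<close> with \<open>k = 2\<close>, or from \<open>B\<close> and \<open>C\<close> with \<open>k = 0\<close>; in these cases
  \<open>x\<close> changes the vector of \<open>y\<close>, and \<open>y\<close> that of \<open>x\<close>, by \<open>(0, 1)\<close>.\<close>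
lemma shift_cocycle:
  "\<forall>k<3. \<forall>x<12. \<forall>y<12.
     xor (shift x k) (shift (act x y) k) = xor (shift y k) (shift (act y x) k)"
  by (simp add: all_less_3 all_less_12 act_def shift_def)

lemma act_cycle:
  assumes "x < 12" "y < 12" "z < 12"
  shows "act (act x y) (act x z) = act (act y x) (act y z)"
proof -
  have "z div 4 < 3" using assms by linarith
  with shift_cocycle assms
  have "xor (shift x (z div 4)) (shift (act x y) (z div 4)) =
      xor (shift y (z div 4)) (shift (act y x) (z div 4))"
    by blast
  then show ?thesis
    by (simp add: act_def[of _ "act _ _"] act_div_4) (simp add: act_def[of _ z] xor.assoc)
qed

interpretation twelve: involutive_cycle_set "{..<12}" act
  by unfold_locales (auto simp: act_less_12 act_act act_cycle intro: act_commute)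

lemma act_square_free: "act x x = x" if "x < 12"
proof -
  have "\<forall>x<12. shift x (x div 4) = 0"
    by (simp add: all_less_12 shift_def)
  then show ?thesis using that by (simp add: act_def)
qed

definition twelve_sol :: "nat quadratic_set" where
  "twelve_sol = sol_of {..<12} act"

definition half_sol :: "nat quadratic_set" where
  "half_sol = (half_collapse ` {..<12},
     map_prod half_collapse half_collapse \<circ> snd twelve_sol)"

text \<open>The trivial solution, in which every \<open>\<sigma>\<^sub>x\<close> is the identity.\<close>
definition flip_sol :: "nat \<Rightarrow> nat quadratic_set" where
  "flip_sol n = ({..<n}, \<lambda>(x, y). (y, x))"

text \<open>The cleared digits of the acting point influence no translation, and clearing a digit is
  compatible with the digitwise addition of a vector.\<close>
lemma half_collapse_act:
  "\<forall>x<12. \<forall>y<12. half_collapse (act (half_collapse x) (half_collapse y)) = half_collapse (act x y)"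
  by (simp add: all_less_12 act_def shift_def half_collapse_def)

lemma half_collapse_idem: "half_collapse (half_collapse x) = half_collapse x"
  by (simp add: half_collapse_def)

lemma half_collapse_div_4: "half_collapse x div 4 = x div 4"
  by (simp add: half_collapse_def) linarith

lemma half_collapse_less: "x < 12 \<Longrightarrow> half_collapse x < 12"
  by (simp add: half_collapse_def) linarith

lemma half_collapse_eq_iff_shift:
  "\<forall>x<12. \<forall>y<12. half_collapse x = half_collapse y \<longleftrightarrow> (\<forall>k<3. shift x k = shift y k)"
  by (simp add: all_less_3 all_less_12 shift_def half_collapse_def)

lemma half_collapse_eq_iff:
  assumes "x < 12" "y < 12"
  shows "half_collapse x = half_collapse y \<longleftrightarrow> (\<forall>z<12. act x z = act y z)"
proof -
  have "(\<forall>k<3. shift x k = shift y k) \<longleftrightarrow> (\<forall>z<12. act x z = act y z)"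
  proof (intro iffI allI impI)
    fix z :: nat assume "\<forall>k<3. shift x k = shift y k" "z < 12"
    moreover from \<open>z < 12\<close> have "z div 4 < 3" by linarith
    ultimately show "act x z = act y z" by (simp add: act_def)
  next
    fix k :: nat assume "\<forall>z<12. act x z = act y z" "k < 3"
    then have "act x (4 * k) = act y (4 * k)" by simp
    then have "xor (4 * k) (xor (4 * k) (shift x k)) = xor (4 * k) (xor (4 * k) (shift y k))"
      by (simp add: act_def)
    then show "shift x k = shift y k" by (simp flip: xor.assoc)
  qed
  then show ?thesis using half_collapse_eq_iff_shift assms by simp
qed

text \<open>After the collapse a point acts like the zero vector of its own orbit: the vectors of
  two points of the same orbit differ only in a low digit on \<open>A\<close> or \<open>C\<close>, which is cleared. The second retract thus has one point per orbit.\<close>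
lemma half_collapse_act_base:
  "\<forall>x<12. \<forall>z<12. half_collapse (act x z) = half_collapse (act (x div 4 * 4) z)"
  by (simp add: all_less_12 act_def shift_def half_collapse_def)

lemma orbit_eq_iff:
  assumes "x < 12" "y < 12"
  shows "x div 4 = y div 4 \<longleftrightarrow> (\<forall>z<12. half_collapse (act x z) = half_collapse (act y z))"
proof
  assume "x div 4 = y div 4"
  then show "\<forall>z<12. half_collapse (act x z) = half_collapse (act y z)"
    using half_collapse_act_base[rule_format, of x] half_collapse_act_base[rule_format, of y] assms
    by metis
next
  have "x div 4 < 3" "y div 4 < 3" using assms by linarith+
  then have "x div 4 \<in> {0, 1, 2}" "y div 4 \<in> {0, 1, 2}" by auto
  moreover assume "\<forall>z<12. half_collapse (act x z) = half_collapse (act y z)"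
  then have "half_collapse (act x 4) = half_collapse (act y 4)"
    by simp
  then have "half_collapse (act (x div 4 * 4) 4) = half_collapse (act (y div 4 * 4) 4)"
    using half_collapse_act_base[rule_format, of x 4] half_collapse_act_base[rule_format, of y 4] assms
    by simp
  ultimately show "x div 4 = y div 4"
    \<comment> \<open>The base points \<open>0\<close>, \<open>4\<close>, \<open>8\<close> send \<open>4\<close> to \<open>6\<close>, \<open>4\<close>, \<open>5\<close>, which are
      three different points of the retract.\<close>
    by (auto simp: act_def shift_def half_collapse_def)
qed

lemma retraction_twelve_sol: "retraction_map half_collapse twelve_sol half_sol"
proof -
  have "half_collapse (act (act (half_collapse x) (half_collapse y)) (half_collapse x)) =
      half_collapse (act (act x y) x)" if "x < 12" "y < 12" for x y
  proof -
    let ?h = half_collapse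
    have "?h (act (act (?h x) (?h y)) (?h x)) = ?h (act (?h (act (?h x) (?h y))) (?h (?h x)))"
      using that by (intro half_collapse_act[rule_format, symmetric] act_less_12 half_collapse_less)
    also have "\<dots> = ?h (act (?h (act x y)) (?h x))"
      using that by (simp add: half_collapse_act half_collapse_idem)
    also have "\<dots> = ?h (act (act x y) x)"
      using that by (intro half_collapse_act[rule_format] act_less_12)
    finally show ?thesis .
  qed
  moreover have "half_collapse x = half_collapse y \<longleftrightarrow> sigma twelve_sol x = sigma twelve_sol y"
    if "x < 12" "y < 12" for x y
    using that half_collapse_eq_iff
    by (auto simp: twelve_sol_def sigma_sol_of fun_eq_iff restrict_def)
  ultimately show ?thesis
    using half_collapse_act
    by (auto simp: retraction_map_def quadratic_epi_def half_sol_def twelve_sol_def)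
qed

lemma retraction_half_sol: "retraction_map (\<lambda>x. x div 4) half_sol (flip_sol 3)"
proof -
  have sig: "sigma half_sol x = (\<lambda>z \<in> half_collapse ` {..<12}. half_collapse (act x z))" for x
    by (simp add: sigma_def half_sol_def twelve_sol_def)
  have "sigma half_sol (half_collapse x) = sigma half_sol (half_collapse y) \<longleftrightarrow>
      half_collapse x div 4 = half_collapse y div 4"
    if xy: "x < 12" "y < 12" for x y
  proof -
    have "sigma half_sol (half_collapse x) = sigma half_sol (half_collapse y) \<longleftrightarrow>
        (\<forall>w \<in> half_collapse ` {..<12}.
           half_collapse (act (half_collapse x) w) = half_collapse (act (half_collapse y) w))"
      by (auto simp: sig restrict_def fun_eq_iff)
    also have "\<dots> \<longleftrightarrow> (\<forall>z<12. half_collapse (act x z) = half_collapse (act y z))"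
      using xy half_collapse_act by auto
    finally show ?thesis
      using orbit_eq_iff xy by (simp add: half_collapse_div_4)
  qed
  moreover have "(\<lambda>x. x div 4) ` half_collapse ` {..<12} = {..<3}"
  proof -
    have "n \<in> (\<lambda>x. x div 4) ` {..<12}" if "n < 3" for n :: nat
      using that by (intro image_eqI[of _ _ "4 * n"]) auto
    then show ?thesis
      by (auto simp: image_image half_collapse_div_4)
  qed
  ultimately show ?thesis
    by (auto simp: retraction_map_def quadratic_epi_def flip_sol_def)
      (auto simp: half_sol_def twelve_sol_def half_collapse_div_4 act_div_4)
qed

lemma retraction_flip_sol:
  assumes "n > 0"
  shows "retraction_map (\<lambda>_. 0) (flip_sol n) (flip_sol 1)"
  using assms by (auto simp: retraction_map_def quadratic_epi_def flip_sol_def sigma_def)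


lemma multipermutation_level_3_twelve_sol: "multipermutation_level_3 twelve_sol"
proof (rule multipermutation_level_3I)
  show "quadratic_closed twelve_sol"
    by (auto simp: quadratic_closed_def twelve_sol_def act_less_12)
  show "retraction_map half_collapse twelve_sol half_sol"
    by (rule retraction_twelve_sol)
  show "retraction_map (\<lambda>x. x div 4) half_sol (flip_sol 3)"
    by (rule retraction_half_sol)
  show "retraction_map (\<lambda>_. 0) (flip_sol 3) (flip_sol 1)"
    by (rule retraction_flip_sol) simp
  have "{0, 4} \<subseteq> half_collapse ` {..<12}"
    by (auto simp: half_collapse_def image_iff intro: bexI[of _ 0] bexI[of _ 4])
  then have "card {0, 4 :: nat} \<le> card (half_collapse ` {..<12})"
    by (intro card_mono) auto
  then show "card (fst half_sol) \<noteq> 1"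
    by (simp add: half_sol_def)
qed (auto simp: twelve_sol_def flip_sol_def)

text \<open>The points 0, 4, 8 represent the orbits; every other point is reached from one of them by at
  most two generators.\<close>
lemma invariant_contains_all:
  assumes "{0, 4, 8} \<subseteq> W" and inv: "\<And>u w. \<lbrakk>u \<in> {..<12}; w \<in> W\<rbrakk> \<Longrightarrow> act u w \<in> W"
  shows "{..<12} \<subseteq> W"
proof -
  have "act 10 0 = 1" "act 4 0 = 2" "act 5 0 = 3" "act 8 4 = 5" "act 0 4 = 6" "act 8 6 = 7"
    "act 2 8 = 9" "act 4 8 = 10" "act 6 8 = 11"
    by (simp_all add: act_def shift_def)
  then have "0 \<in> W" "1 \<in> W" "2 \<in> W" "3 \<in> W" "4 \<in> W" "5 \<in> W" "6 \<in> W" "7 \<in> W" "8 \<in> W"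
    "9 \<in> W" "10 \<in> W" "11 \<in> W"
    using assms(1) inv[of 10 0] inv[of 4 0] inv[of 5 0] inv[of 8 4] inv[of 0 4] inv[of 8 6]
      inv[of 2 8] inv[of 4 8] inv[of 6 8] by auto
  then have "\<forall>x<12. x \<in> W" by (simp add: all_less_12)
  then show ?thesis by blast
qed

text \<open>Neither part contains all of 0, 4, 8, so up to naming one of the orbits \<open>A\<close>, \<open>B\<close>, \<open>C\<close> is
  isolated. Then \<open>A\<close> and \<open>B\<close> are separated, with an effect visible on \<open>C\<close>, or \<open>B\<close> and \<open>C\<close> are, with an
  effect visible on \<open>A\<close>. Which of the two conditions is violated depends on the side of the orbit
  on which the effect is visible.\<close>
lemma not_generalized_twisted_union_twelve_sol: "\<not> generalized_twisted_union twelve_sol"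
proof
  assume "generalized_twisted_union twelve_sol"
  then obtain Y Z where ne: "Y \<noteq> {}" "Z \<noteq> {}" and disj: "Y \<inter> Z = {}" and un: "Y \<union> Z = {..<12}"
    and invY: "\<forall>x\<in>{..<12}. \<forall>y\<in>Y. act x y \<in> Y"
    and invZ: "\<forall>x\<in>{..<12}. \<forall>z\<in>Z. act x z \<in> Z"
    and "\<forall>z\<in>Z. \<forall>y\<in>Y. \<forall>y'\<in>Y. \<forall>w\<in>Y. act (act (act z y) z) w = act (act (act z y') z) w"
    and "\<forall>z\<in>Z. \<forall>z'\<in>Z. \<forall>y\<in>Y. \<forall>w\<in>Z. act (act w (act z y)) w = act (act w (act z' y)) w"
    unfolding twelve_sol_def
    by (rule twisted_union_condition) (simp add: act_less_12, rule that)
  note cY = this(7)[rule_format] and cZ = this(8)[rule_format]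
  have "\<not> {0, 4, 8} \<subseteq> Y"
    using invariant_contains_all[of Y] invY ne disj un by blast
  moreover have "\<not> {0, 4, 8} \<subseteq> Z"
    using invariant_contains_all[of Z] invZ ne disj un by blast
  moreover have "0 \<in> Y \<union> Z" "4 \<in> Y \<union> Z" "8 \<in> Y \<union> Z"
    by (simp_all add: un)
  ultimately consider "0 \<in> Y" "4 \<in> Z" "8 \<in> Z" | "0 \<in> Z" "4 \<in> Y" "8 \<in> Y"
    | "4 \<in> Y" "0 \<in> Z" "8 \<in> Z" | "4 \<in> Z" "0 \<in> Y" "8 \<in> Y"
    | "8 \<in> Y" "0 \<in> Z" "4 \<in> Z" | "8 \<in> Z" "0 \<in> Y" "4 \<in> Y"
    by blast
  then show False
  proof cases
    case 1
    \<comment> \<open>The point 4 flips the high digit of \<open>0 \<in> A\<close>, and 8 does not; \<open>8 \<in> C\<close> sees the difference.\<close>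
    then show False using cZ[of 4 8 0 8] by (simp add: act_def shift_def)
  next
    case 2
    \<comment> \<open>The same pair \<open>A, B\<close> with the sides exchanged: \<open>\<gamma>\<^sub>4\<close> flips the high digit of 0, and \<open>\<gamma>\<^sub>8\<close> does not.\<close>
    then show False using cY[of 0 4 8 8] by (simp add: act_def shift_def)
  next
    case 3
    then show False using cZ[of 0 8 4 8] by (simp add: act_def shift_def)
  next
    case 4
    then show False using cY[of 4 0 8 8] by (simp add: act_def shift_def)
  next
    case 5
    then show False using cZ[of 4 0 8 0] by (simp add: act_def shift_def)
  next
    case 6
    then show False using cY[of 8 4 0 0] by (simp add: act_def shift_def)
  qed
qed

theorem theorem3p1:
  "\<exists>S :: nat quadratic_set.
     inv_nondeg_solution S \<and> square_free_solution S \<and>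
     multipermutation_level_3 S \<and>
     \<not> generalized_twisted_union S \<and>
     comm_group (IYB_group S)"
proof (intro exI conjI)
  show "inv_nondeg_solution twelve_sol"
    unfolding twelve_sol_def by (rule twelve.inv_nondeg_solution)
  show "square_free_solution twelve_sol"
    by (simp add: square_free_solution_def twelve_sol_def act_square_free)
  show "multipermutation_level_3 twelve_sol"
    by (rule multipermutation_level_3_twelve_sol)
  show "\<not> generalized_twisted_union twelve_sol"
    by (rule not_generalized_twisted_union_twelve_sol)
  show "comm_group (IYB_group twelve_sol)"
    unfolding twelve_sol_def by (rule twelve.comm_group_IYB)
qed

end
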